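(* A reductive symplectic symmetric triple that is indecomposable and non-flat is simple.
   Context: A symplectic symmetric triple is a triple $t=(\mathcal{G},\sigma,\Omega)$ where: (i) $\mathcal{G}$ is a finite-dimensional real Lie algebra; (ii) $\sigma$ is an involutive automorphism of $\mathcal{G}$ such that, writing $\mathcal{G}=\mathcal{K}\oplus\mathcal{P}$ with $\sigma=\mathrm{id}_{\mathcal{K}}\oplus(-\mathrm{id}_{\mathcal{P}})$, one has $[\mathcal{P},\mathcal{P}]=\mathcal{K}$ and $\mathcal{K}$ acts faithfully on $\mathcal{P}$; (iii) $\Omega$ is a $\mathcal{K}$-invariant symplectic form on $\mathcal{P}$. It is flat if $\mathcal{K}=\{0\}$; reductive (resp. simple) if $\mathcal{G}$ is a reductive (resp. simple) Lie algebra. Direct sums of triples are defined in the obvious way (direct sum of Lie algebras, of involutions, and orthogonal direct sum of symplectic forms); a triple is indecomposable if it is not a direct sum of two non-trivial triples. *)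

theory Defs
  imports "HOL-Analysis.Product_Vector"
begin

text \<open>
  Vector spaces are linear subspaces of an ambient real vector space type. The operations
  of the records below are total functions; only their values on the relevant subspace matter.
\<close>

definition finite_dim_subspace :: "'a::real_vector set \<Rightarrow> bool" where
  "finite_dim_subspace V \<longleftrightarrow> (\<exists>B. finite B \<and> V = span B)"

definition linear_map_on :: "'a::real_vector set \<Rightarrow> ('a \<Rightarrow> 'b::real_vector) \<Rightarrow> bool" where
  "linear_map_on V f \<longleftrightarrow>
     (\<forall>x\<in>V. \<forall>y\<in>V. f (x + y) = f x + f y) \<and>
     (\<forall>c. \<forall>x\<in>V. f (c *\<^sub>R x) = c *\<^sub>R f x)"

definition bilinear_map_on :: "'a::real_vector set \<Rightarrow> ('a \<Rightarrow> 'a \<Rightarrow> 'b::real_vector) \<Rightarrow> bool" where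
  "bilinear_map_on V f \<longleftrightarrow>
     (\<forall>x\<in>V. linear_map_on V (\<lambda>y. f x y)) \<and> (\<forall>y\<in>V. linear_map_on V (\<lambda>x. f x y))"

definition direct_sum_decomp :: "'a::real_vector set \<Rightarrow> 'a set \<Rightarrow> 'a set \<Rightarrow> bool" where
  "direct_sum_decomp V I J \<longleftrightarrow> I \<inter> J = {0} \<and> V = {x + y | x y. x \<in> I \<and> y \<in> J}"


record 'a lie_alg =
  lie_carrier :: "'a set"
  lie_bracket :: "'a \<Rightarrow> 'a \<Rightarrow> 'a"

definition fd_lie_algebra :: "('a::real_vector, 'm) lie_alg_scheme \<Rightarrow> bool" where
  "fd_lie_algebra L \<longleftrightarrow>
     finite_dim_subspace (lie_carrier L) \<and>
     (\<forall>x\<in>lie_carrier L. \<forall>y\<in>lie_carrier L. lie_bracket L x y \<in> lie_carrier L) \<and>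
     bilinear_map_on (lie_carrier L) (lie_bracket L) \<and>
     (\<forall>x\<in>lie_carrier L. lie_bracket L x x = 0) \<and>
     (\<forall>x\<in>lie_carrier L. \<forall>y\<in>lie_carrier L. \<forall>z\<in>lie_carrier L.
        lie_bracket L x (lie_bracket L y z) + lie_bracket L y (lie_bracket L z x)
          + lie_bracket L z (lie_bracket L x y) = 0)"

definition lie_ideal :: "'a::real_vector set \<Rightarrow> ('a, 'm) lie_alg_scheme \<Rightarrow> bool" where
  "lie_ideal I L \<longleftrightarrow>
     subspace I \<and> I \<subseteq> lie_carrier L \<and>
     (\<forall>x\<in>lie_carrier L. \<forall>y\<in>I. lie_bracket L x y \<in> I)"

definition abelian_lie :: "('a::real_vector, 'm) lie_alg_scheme \<Rightarrow> bool" where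
  "abelian_lie L \<longleftrightarrow> (\<forall>x\<in>lie_carrier L. \<forall>y\<in>lie_carrier L. lie_bracket L x y = 0)"

definition simple_lie :: "('a::real_vector, 'm) lie_alg_scheme \<Rightarrow> bool" where
  "simple_lie L \<longleftrightarrow>
     fd_lie_algebra L \<and> \<not> abelian_lie L \<and>
     (\<forall>I. lie_ideal I L \<longrightarrow> I = {0} \<or> I = lie_carrier L)"

text \<open>
  Reductive means that the adjoint representation is completely reducible. Its invariant
  subspaces are the ideals, so every ideal is required to have a complementary ideal.
\<close>

definition reductive_lie :: "('a::real_vector, 'm) lie_alg_scheme \<Rightarrow> bool" where
  "reductive_lie L \<longleftrightarrow>
     fd_lie_algebra L \<and>
     (\<forall>I. lie_ideal I L \<longrightarrow> (\<exists>J. lie_ideal J L \<and> direct_sum_decomp (lie_carrier L) I J))"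

definition lie_automorphism :: "('a::real_vector, 'm) lie_alg_scheme \<Rightarrow> ('a \<Rightarrow> 'a) \<Rightarrow> bool" where
  "lie_automorphism L f \<longleftrightarrow>
     linear_map_on (lie_carrier L) f \<and>
     bij_betw f (lie_carrier L) (lie_carrier L) \<and>
     (\<forall>x\<in>lie_carrier L. \<forall>y\<in>lie_carrier L.
        f (lie_bracket L x y) = lie_bracket L (f x) (f y))"


record 'a triple = "'a lie_alg" +
  invol :: "'a \<Rightarrow> 'a"
  form :: "'a \<Rightarrow> 'a \<Rightarrow> real"

definition K_part :: "'a::real_vector triple \<Rightarrow> 'a set" where
  "K_part t = {x \<in> lie_carrier t. invol t x = x}"

definition P_part :: "'a::real_vector triple \<Rightarrow> 'a set" where
  "P_part t = {x \<in> lie_carrier t. invol t x = - x}"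

definition symplectic_form_on :: "'a::real_vector set \<Rightarrow> ('a \<Rightarrow> 'a \<Rightarrow> real) \<Rightarrow> bool" where
  "symplectic_form_on V w \<longleftrightarrow>
     bilinear_map_on V w \<and>
     (\<forall>x\<in>V. w x x = 0) \<and>
     (\<forall>x\<in>V. (\<forall>y\<in>V. w x y = 0) \<longrightarrow> x = 0)"

text \<open>
  The decomposition of the carrier as the direct sum of \<open>K_part t\<close> and \<open>P_part t\<close> is not
  listed, since it holds for every linear involution. The set \<open>[P, P]\<close> is the linear span of
  the brackets.
\<close>

definition symplectic_symmetric_triple :: "'a::real_vector triple \<Rightarrow> bool" where
  "symplectic_symmetric_triple t \<longleftrightarrow>
     fd_lie_algebra t \<and>
     lie_automorphism t (invol t) \<and>
     (\<forall>x\<in>lie_carrier t. invol t (invol t x) = x) \<and>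
     span {lie_bracket t x y | x y. x \<in> P_part t \<and> y \<in> P_part t} = K_part t \<and>
     (\<forall>k\<in>K_part t. (\<forall>x\<in>P_part t. lie_bracket t k x = 0) \<longrightarrow> k = 0) \<and>
     symplectic_form_on (P_part t) (form t) \<and>
     (\<forall>k\<in>K_part t. \<forall>x\<in>P_part t. \<forall>y\<in>P_part t.
        form t (lie_bracket t k x) y + form t x (lie_bracket t k y) = 0)"

definition flat_triple :: "'a::real_vector triple \<Rightarrow> bool" where
  "flat_triple t \<longleftrightarrow> K_part t = {0}"

definition reductive_triple :: "'a::real_vector triple \<Rightarrow> bool" where
  "reductive_triple t \<longleftrightarrow> reductive_lie t"

definition simple_triple :: "'a::real_vector triple \<Rightarrow> bool" where
  "simple_triple t \<longleftrightarrow> simple_lie t"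

definition triple_sum :: "'a::real_vector triple \<Rightarrow> 'b::real_vector triple \<Rightarrow> ('a \<times> 'b) triple" where
  "triple_sum s t =
     \<lparr> lie_carrier = lie_carrier s \<times> lie_carrier t,
       lie_bracket = (\<lambda>x y. (lie_bracket s (fst x) (fst y), lie_bracket t (snd x) (snd y))),
       invol = map_prod (invol s) (invol t),
       form = (\<lambda>x y. form s (fst x) (fst y) + form t (snd x) (snd y)) \<rparr>"

definition triple_isomorphic :: "'a::real_vector triple \<Rightarrow> 'b::real_vector triple \<Rightarrow> bool" where
  "triple_isomorphic s t \<longleftrightarrow>
     (\<exists>f. linear_map_on (lie_carrier s) f \<and>
          bij_betw f (lie_carrier s) (lie_carrier t) \<and>
          (\<forall>x\<in>lie_carrier s. \<forall>y\<in>lie_carrier s.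
             f (lie_bracket s x y) = lie_bracket t (f x) (f y)) \<and>
          (\<forall>x\<in>lie_carrier s. f (invol s x) = invol t (f x)) \<and>
          (\<forall>x\<in>P_part s. \<forall>y\<in>P_part s. form s x y = form t (f x) (f y)))"

text \<open>
  Letting the summands range over triples in the ambient type \<open>'a\<close> of \<open>t\<close> loses nothing: a
  summand of \<open>t\<close> is isomorphic to a triple whose carrier is a subspace of that of \<open>t\<close>.
\<close>

definition indecomposable_triple :: "'a::real_vector triple \<Rightarrow> bool" where
  "indecomposable_triple t \<longleftrightarrow>
     \<not> (\<exists>(s1 :: 'a triple) (s2 :: 'a triple).
          symplectic_symmetric_triple s1 \<and> symplectic_symmetric_triple s2 \<and>
          lie_carrier s1 \<noteq> {0} \<and> lie_carrier s2 \<noteq> {0} \<and>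
          triple_isomorphic t (triple_sum s1 s2))"

end

theory Submission imports Defs begin

text \<open>
  Let \<open>G\<close> be the Lie algebra of the triple, \<open>\<sigma>\<close> its involution and \<open>\<Omega>\<close> its form. Reductivity
  provides complementary ideals, and the theorem follows from what \<open>\<sigma>\<close> and \<open>\<Omega>\<close> can do to them.

  Complementary ideals \<open>I\<close> and \<open>J\<close> commute. If both are \<open>\<sigma>\<close>-stable and one of them, say \<open>I\<close>, is
  perfect (\<open>[I, I] = I\<close>), then \<open>\<Omega>\<close> makes \<open>P \<inter> I\<close> orthogonal to \<open>P \<inter> J\<close>
  (\<open>perfect_summand_orthogonal\<close>): \<open>P \<inter> I\<close> is spanned by brackets \<open>[k, p]\<close> with \<open>k\<close> in \<open>K \<inter> I\<close>,
  and such a \<open>k\<close> annihilates \<open>J\<close>. The triple is then the direct sum of its restrictions to \<open>I\<close>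
  and \<open>J\<close>, so in an indecomposable triple \<open>I = 0\<close> or \<open>J = 0\<close>
  (\<open>indecomposable_invariant_decomp\<close>).

  This is applied first to \<open>G = [G, G] \<oplus> Z(G)\<close>, whose first summand is perfect because central
  components do not contribute to brackets. Since \<open>K \<noteq> 0\<close> acts faithfully, \<open>G\<close> is not abelian,
  so the centre vanishes and \<open>G\<close> is perfect. Consequently every ideal is perfect and has its
  centralizer as a complement. A \<open>\<sigma>\<close>-stable ideal has a \<open>\<sigma>\<close>-stable centralizer, hence
  is \<open>0\<close> or \<open>G\<close>.

  For a proper nonzero ideal \<open>I\<close> the \<open>\<sigma>\<close>-stable ideals \<open>I \<inter> \<sigma> I\<close> and \<open>I + \<sigma> I\<close> must therefore be
  \<open>0\<close> and \<open>G\<close>, that is, \<open>\<sigma>\<close> swaps two complementary copies of \<open>I\<close>. Then \<open>\<Omega>\<close> induces on \<open>I\<close> a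
  nondegenerate antisymmetric form that is invariant under the adjoint action. But an invariant
  antisymmetric form \<open>w\<close> satisfies \<open>w [x, y] z = 0\<close> (\<open>invariant_skew_form_bracket_zero\<close>), so on
  the perfect algebra \<open>I\<close> it is zero, a contradiction (\<open>no_swapped_ideal\<close>).
\<close>

section \<open>Ideals of Lie algebras\<close>

definition bracket_span :: "('a::real_vector, 'm) lie_alg_scheme \<Rightarrow> 'a set \<Rightarrow> 'a set" where
  "bracket_span L A = span {lie_bracket L x y | x y. x \<in> A \<and> y \<in> A}"

definition centralizer :: "('a::real_vector, 'm) lie_alg_scheme \<Rightarrow> 'a set \<Rightarrow> 'a set" where
  "centralizer L A = {x \<in> lie_carrier L. \<forall>y\<in>A. lie_bracket L x y = 0}"

lemma finite_dim_subspace_imp_subspace: "finite_dim_subspace V \<Longrightarrow> subspace V"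
  by (auto simp: finite_dim_subspace_def)

lemma finite_dim_subspace_subset:
  assumes "finite_dim_subspace V" "subspace W" "W \<subseteq> V"
  shows "finite_dim_subspace W"
proof -
  obtain B where B: "finite B" "V = span B"
    using assms(1) by (auto simp: finite_dim_subspace_def)
  obtain C where C: "C \<subseteq> W" "independent C" "W \<subseteq> span C"
    by (metis maximal_independent_subset)
  have "finite C"
    using independent_span_bound[OF B(1) C(2)] C(1) assms(3) B(2) by blast
  moreover have "span C = W"
    using C assms(2) by (meson span_minimal subset_antisym)
  ultimately show ?thesis by (auto simp: finite_dim_subspace_def)
qed

lemma bilinear_map_on_subset:
  "bilinear_map_on V f \<Longrightarrow> W \<subseteq> V \<Longrightarrow> bilinear_map_on W f"
  unfolding bilinear_map_on_def linear_map_on_def by blast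

lemma direct_sum_decomp_sym: "direct_sum_decomp V I J \<Longrightarrow> direct_sum_decomp V J I"
  unfolding direct_sum_decomp_def by (auto simp: add.commute) (metis add.commute)+

lemma direct_sum_decomp_obtain:
  assumes "direct_sum_decomp V I J" "x \<in> V"
  obtains a b where "a \<in> I" "b \<in> J" "x = a + b"
  using assms unfolding direct_sum_decomp_def by auto

locale finite_dim_lie_algebra =
  fixes L :: "('a::real_vector, 'm) lie_alg_scheme"
  assumes fd_lie: "fd_lie_algebra L"
begin

abbreviation G where "G \<equiv> lie_carrier L"
abbreviation br where "br \<equiv> lie_bracket L"

lemma subspace_G: "subspace G"
  using fd_lie by (auto simp: fd_lie_algebra_def intro: finite_dim_subspace_imp_subspace)

lemma G_closed [simp]:
  "0 \<in> G" "x \<in> G \<Longrightarrow> y \<in> G \<Longrightarrow> x + y \<in> G" "x \<in> G \<Longrightarrow> y \<in> G \<Longrightarrow> x - y \<in> G"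
  "x \<in> G \<Longrightarrow> - x \<in> G" "x \<in> G \<Longrightarrow> c *\<^sub>R x \<in> G" "x \<in> G \<Longrightarrow> y \<in> G \<Longrightarrow> br x y \<in> G"
  using subspace_G fd_lie
  by (auto simp: subspace_0 subspace_add subspace_diff subspace_neg subspace_scale
      fd_lie_algebra_def)

lemma br_linear:
  assumes "x \<in> G" "y \<in> G" "z \<in> G"
  shows "br (x + y) z = br x z + br y z" "br z (x + y) = br z x + br z y"
    "br (c *\<^sub>R x) y = c *\<^sub>R br x y" "br y (c *\<^sub>R x) = c *\<^sub>R br y x"
  using fd_lie assms by (auto simp: fd_lie_algebra_def bilinear_map_on_def linear_map_on_def)

lemma br_zero: "x \<in> G \<Longrightarrow> br 0 x = 0" "x \<in> G \<Longrightarrow> br x 0 = 0"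
  using br_linear(3)[of 0 x x 0] br_linear(4)[of 0 x x 0] by auto

lemma br_neg: 
  assumes "x \<in> G" "y \<in> G"
  shows "br (- x) y = - br x y" "br y (- x) = - br y x"
  using br_linear(3)[of x y x "-1"] br_linear(4)[of x y x "-1"] assms by auto

lemma br_diff:
  assumes "x \<in> G" "y \<in> G" "z \<in> G"
  shows "br (x - y) z = br x z - br y z" "br z (x - y) = br z x - br z y"
  using br_linear(1)[of x "- y" z] br_linear(2)[of x "- y" z] br_neg[of y z] assms by auto

lemma br_self: "x \<in> G \<Longrightarrow> br x x = 0"
  using fd_lie by (auto simp: fd_lie_algebra_def)

lemma br_anticommute:
  assumes "x \<in> G" "y \<in> G"
  shows "br x y = - br y x"
proof -
  have "br x (x + y) + br y (x + y) = 0"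
    using assms br_self[of "x + y"] br_linear(1)[of x y "x + y"] by simp
  then show ?thesis
    using assms by (simp add: br_linear br_self eq_neg_iff_add_eq_0)
qed

lemma br_jacobi:
  "x \<in> G \<Longrightarrow> y \<in> G \<Longrightarrow> z \<in> G \<Longrightarrow> br x (br y z) + br y (br z x) + br z (br x y) = 0"
  using fd_lie by (auto simp: fd_lie_algebra_def)

lemma subspace_ideal: "lie_ideal I L \<Longrightarrow> subspace I"
  and ideal_subset: "lie_ideal I L \<Longrightarrow> I \<subseteq> G"
  and ideal_br: "lie_ideal I L \<Longrightarrow> x \<in> G \<Longrightarrow> y \<in> I \<Longrightarrow> br x y \<in> I"
  by (auto simp: lie_ideal_def)

lemma ideal_br_left: "lie_ideal I L \<Longrightarrow> x \<in> I \<Longrightarrow> y \<in> G \<Longrightarrow> br x y \<in> I"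
  by (metis br_anticommute ideal_br ideal_subset subsetD subspace_ideal subspace_neg)

lemma ideal_whole: "lie_ideal G L"
  by (auto simp: lie_ideal_def subspace_G)

lemma br_disjoint_ideals:
  assumes "lie_ideal I L" "lie_ideal J L" "I \<inter> J = {0}" "x \<in> I" "y \<in> J"
  shows "br x y = 0"
proof -
  have "br x y \<in> I" "br x y \<in> J"
    using ideal_br_left[OF assms(1,4)] ideal_br[OF assms(2) _ assms(5)]
      ideal_subset[OF assms(1)] ideal_subset[OF assms(2)] assms(4,5) by auto
  then show ?thesis using assms(3) by blast
qed

lemma bracket_span_subset_ideal:
  assumes I: "lie_ideal I L" and A: "A \<subseteq> I"
  shows "bracket_span L A \<subseteq> I"
proof -
  have "br x y \<in> I" if "x \<in> A" "y \<in> A" for x y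
    using ideal_br[OF I, of x y] ideal_subset[OF I] A that by auto
  then show ?thesis
    unfolding bracket_span_def by (intro span_minimal subspace_ideal[OF I]) auto
qed

text \<open>Since the two ideals commute, \<open>[a + b, a' + b'] = [a, a'] + [b, b']\<close>; an element of \<open>I\<close>
  that is a combination of such brackets loses its component in \<open>J\<close>.\<close>

lemma bracket_span_component:
  assumes I: "lie_ideal I L" and J: "lie_ideal J L" and IJ: "I \<inter> J = {0}"
    and A: "A \<subseteq> I" and B: "B \<subseteq> J" and S: "S \<subseteq> {a + b | a b. a \<in> A \<and> b \<in> B}"
    and x: "x \<in> I" "x \<in> bracket_span L S"
  shows "x \<in> bracket_span L A"
proof -
  let ?T = "{u + v | u v. u \<in> bracket_span L A \<and> v \<in> bracket_span L B}"
  have sub: "subspace ?T"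
    by (rule subspace_sums) (auto simp: bracket_span_def)
  have "br y z \<in> ?T" if yz: "y \<in> S" "z \<in> S" for y z
  proof -
    obtain a b a' b' where ab: "y = a + b" "z = a' + b'" "a \<in> A" "b \<in> B" "a' \<in> A" "b' \<in> B"
      using yz S by blast
    then have mem: "a \<in> G" "b \<in> G" "a' \<in> G" "b' \<in> G"
      using A B ideal_subset[OF I] ideal_subset[OF J] by blast+
    have "br a b' = 0" "br b a' = 0"
      using br_disjoint_ideals[OF I J IJ, of a b'] br_disjoint_ideals[OF J I, of b a'] IJ ab A B
      by (auto simp: Int_commute)
    then have "br y z = br a a' + br b b'"
      using mem by (simp add: ab br_linear)
    moreover have "br a a' \<in> bracket_span L A" "br b b' \<in> bracket_span L B"
      unfolding bracket_span_def using ab by (auto intro: span_base)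
    ultimately show ?thesis by blast
  qed
  then have "bracket_span L S \<subseteq> ?T"
    unfolding bracket_span_def[of L S] by (intro span_minimal sub) auto
  then obtain u v where uv: "x = u + v" "u \<in> bracket_span L A" "v \<in> bracket_span L B"
    using x by blast
  have "bracket_span L A \<subseteq> I" "bracket_span L B \<subseteq> J"
    using bracket_span_subset_ideal[OF I A] bracket_span_subset_ideal[OF J B] by auto
  then have "v \<in> J" "u \<in> I" using uv by auto
  moreover have "v = x - u" using uv by simp
  ultimately have "v \<in> I \<inter> J"
    using subspace_diff[OF subspace_ideal[OF I]] x(1) by simp
  then show ?thesis using uv IJ by simp
qed

lemma summand_perfect:
  assumes "lie_ideal I L" "lie_ideal J L" "direct_sum_decomp G I J" "I \<subseteq> bracket_span L G"
  shows "I \<subseteq> bracket_span L I"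
  using bracket_span_component[OF assms(1,2), of I J G] assms(3,4)
  by (auto simp: direct_sum_decomp_def)

lemma ideal_bracket_span: "lie_ideal (bracket_span L G) L"
proof -
  have sub: "bracket_span L G \<subseteq> G"
    by (rule bracket_span_subset_ideal[OF ideal_whole]) simp
  moreover have "br x y \<in> bracket_span L G" if "x \<in> G" "y \<in> bracket_span L G" for x y
    using that sub unfolding bracket_span_def by (auto intro!: span_base)
  ultimately show ?thesis by (auto simp: lie_ideal_def bracket_span_def)
qed

lemma ideal_centralizer:
  assumes I: "lie_ideal I L"
  shows "lie_ideal (centralizer L I) L"
proof -
  have IG: "I \<subseteq> G" using I by (rule ideal_subset)
  have "subspace (centralizer L I)"
    using IG by (intro subspaceI) (auto simp: centralizer_def br_zero br_linear subsetD)
  moreover have "br x c \<in> centralizer L I" if x: "x \<in> G" and c: "c \<in> centralizer L I" for x c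
  proof -
    have cG: "c \<in> G" and cI: "\<And>y. y \<in> I \<Longrightarrow> br c y = 0" 
      using c by (auto simp: centralizer_def)
    have "br (br x c) y = 0" if y: "y \<in> I" for y
    proof -
      have yG: "y \<in> G" using y IG by blast
      have "br y x \<in> I" using ideal_br_left[OF I y x] .
      then have "br c (br y x) = 0" by (rule cI)
      moreover have "br x (br c y) = 0" using cI[OF y] x by (simp add: br_zero)
      ultimately have "br y (br x c) = 0" using br_jacobi[OF x cG yG] by simp
      then show ?thesis using br_anticommute[of "br x c" y] x cG yG by simp
    qed
    then show ?thesis using x cG by (simp add: centralizer_def)
  qed
  ultimately show ?thesis by (auto simp: lie_ideal_def centralizer_def)
qed

text \<open>An arbitrary complementary ideal \<open>J\<close> commutes with \<open>I\<close>. An element of the centralizer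
  that lies in \<open>I\<close> commutes with \<open>I\<close> and with \<open>J\<close>, hence with everything. So without a centre
  the complement is the centralizer, which inherits every symmetry of \<open>I\<close>.\<close>

lemma centralizer_complement:
  assumes red: "reductive_lie L" and Z: "centralizer L G = {0}" and I: "lie_ideal I L"
  shows "direct_sum_decomp G I (centralizer L I)"
proof -
  obtain J where J: "lie_ideal J L" and D: "direct_sum_decomp G I J"
    using red I by (auto simp: reductive_lie_def)
  then have IJ: "I \<inter> J = {0}" and GIJ: "G = {x + y | x y. x \<in> I \<and> y \<in> J}"
    by (auto simp: direct_sum_decomp_def)
  have IG: "I \<subseteq> G" and JG: "J \<subseteq> G" using I J ideal_subset by auto
  have JC: "J \<subseteq> centralizer L I"
    using br_disjoint_ideals[OF J I] IJ JG by (auto simp: centralizer_def Int_commute)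
  have triv: "x = 0" if x: "x \<in> I" "x \<in> centralizer L I" for x
  proof -
    have "br x y = 0" if y: "y \<in> G" for y
    proof -
      obtain a b where ab: "a \<in> I" "b \<in> J" "y = a + b"
        using direct_sum_decomp_obtain[OF D y] .
      have "br x a = 0" using x ab by (simp add: centralizer_def)
      moreover have "br x b = 0" using br_disjoint_ideals[OF I J IJ x(1) ab(2)] .
      ultimately show ?thesis using ab x IG JG by (simp add: br_linear subsetD)
    qed
    then have "x \<in> centralizer L G" using x IG by (auto simp: centralizer_def)
    then show ?thesis using Z by simp
  qed
  have "0 \<in> I \<inter> centralizer L I"
    using IJ JC by blast
  then have "I \<inter> centralizer L I = {0}" using triv by blast
  moreover have "G = {x + y | x y. x \<in> I \<and> y \<in> centralizer L I}"
  proof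
    show "G \<subseteq> {x + y | x y. x \<in> I \<and> y \<in> centralizer L I}" using GIJ JC by blast
    show "{x + y | x y. x \<in> I \<and> y \<in> centralizer L I} \<subseteq> G"
      using IG by (auto simp: centralizer_def)
  qed
  ultimately show ?thesis by (simp add: direct_sum_decomp_def)
qed

text \<open>A complement of \<open>[G, G]\<close> is central because its brackets with \<open>G\<close> lie in both summands.
  A complement of the centre contains \<open>[G, G]\<close>, so the centre meets \<open>[G, G]\<close> trivially.\<close>

lemma derived_centre_decomp:
  assumes red: "reductive_lie L"
  shows "direct_sum_decomp G (bracket_span L G) (centralizer L G)"
proof -
  let ?D = "bracket_span L G" and ?Z = "centralizer L G"
  obtain C where C: "lie_ideal C L" and DC: "direct_sum_decomp G ?D C"
    using red ideal_bracket_span by (auto simp: reductive_lie_def)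
  obtain W where W: "lie_ideal W L" and ZW: "direct_sum_decomp G ?Z W"
    using red ideal_centralizer[OF ideal_whole] by (auto simp: reductive_lie_def)
  have CZ: "C \<subseteq> ?Z"
  proof
    fix c assume c: "c \<in> C"
    then have cG: "c \<in> G" using ideal_subset[OF C] by blast
    have "br c y = 0" if "y \<in> G" for y
    proof -
      have "br c y \<in> C" using ideal_br_left[OF C c that] .
      moreover have "br c y \<in> ?D" using cG that by (auto simp: bracket_span_def intro: span_base)
      ultimately show ?thesis using DC by (auto simp: direct_sum_decomp_def)
    qed
    then show "c \<in> ?Z" using cG by (simp add: centralizer_def)
  qed
  have "br x y \<in> W" if "x \<in> G" "y \<in> G" for x y
  proof -
    obtain a b where ab: "a \<in> ?Z" "b \<in> W" "x = a + b"
      using direct_sum_decomp_obtain[OF ZW \<open>x \<in> G\<close>] .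
    have "a \<in> G" "b \<in> G" using ab ideal_subset[OF W] by (auto simp: centralizer_def)
    then have "br x y = br b y" using ab that by (simp add: br_linear centralizer_def)
    then show ?thesis using ideal_br_left[OF W ab(2) that(2)] by simp
  qed
  then have "?D \<subseteq> W"
    unfolding bracket_span_def by (intro span_minimal subspace_ideal[OF W]) auto
  then have "?D \<inter> ?Z = {0}"
    using ZW ideal_bracket_span[THEN subspace_ideal, THEN subspace_0]
    unfolding direct_sum_decomp_def by blast
  moreover have "G = {x + y | x y. x \<in> ?D \<and> y \<in> ?Z}"
  proof
    show "G \<subseteq> {x + y | x y. x \<in> ?D \<and> y \<in> ?Z}"
      using DC CZ unfolding direct_sum_decomp_def by blast
    show "{x + y | x y. x \<in> ?D \<and> y \<in> ?Z} \<subseteq> G"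
      using ideal_subset[OF ideal_bracket_span] by (auto simp: centralizer_def)
  qed
  ultimately show ?thesis by (simp add: direct_sum_decomp_def)
qed

text \<open>Invariance and antisymmetry of \<open>w\<close> make \<open>w [x, y] z\<close> symmetric in \<open>y\<close> and \<open>z\<close>, while it is
  antisymmetric in \<open>x\<close> and \<open>y\<close>; the two symmetries force it to vanish.\<close>

lemma invariant_skew_form_bracket_zero:
  fixes w :: "'a \<Rightarrow> 'a \<Rightarrow> real"
  assumes skew: "\<And>x y. x \<in> I \<Longrightarrow> y \<in> I \<Longrightarrow> w x y = - w y x"
    and neg: "\<And>x y. x \<in> I \<Longrightarrow> y \<in> I \<Longrightarrow> w (- x) y = - w x y"
    and inv: "\<And>x y z. x \<in> I \<Longrightarrow> y \<in> I \<Longrightarrow> z \<in> I \<Longrightarrow> w (br x y) z + w y (br x z) = 0"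
    and I: "lie_ideal I L" and xyz: "x \<in> I" "y \<in> I" "z \<in> I"
  shows "w (br x y) z = 0"
proof -
  have cl: "br u v \<in> I" if "u \<in> I" "v \<in> I" for u v
    using that I ideal_br ideal_subset by blast
  have sym: "w (br u v) s = w (br u s) v" if "u \<in> I" "v \<in> I" "s \<in> I" for u v s
    using inv[OF that] skew[of v "br u s"] cl that by simp
  have alt: "w (br u v) s = - w (br v u) s" if "u \<in> I" "v \<in> I" "s \<in> I" for u v s
    using neg[of "br v u" s] cl that br_anticommute[of u v] ideal_subset[OF I] by (metis subsetD)
  have "w (br x y) z = - w (br y x) z" by (rule alt) (use xyz in auto)
  also have "\<dots> = - w (br y z) x" using sym[of y x z] xyz by simp
  also have "\<dots> = w (br z y) x" using alt[of y z x] xyz by simp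
  also have "\<dots> = w (br z x) y" using sym[of z y x] xyz by simp
  also have "\<dots> = - w (br x z) y" using alt[of z x y] xyz by simp
  also have "\<dots> = - w (br x y) z" using sym[of x z y] xyz by simp
  finally show ?thesis by simp
qed

end

section \<open>Splitting a triple along invariant ideals\<close>

locale sympl_sym_triple =
  fixes t :: "'a::real_vector triple"
  assumes triple: "symplectic_symmetric_triple t"

sublocale sympl_sym_triple \<subseteq> finite_dim_lie_algebra t
  using triple by unfold_locales (simp add: symplectic_symmetric_triple_def)

context sympl_sym_triple
begin

abbreviation \<sigma> where "\<sigma> \<equiv> invol t"
abbreviation \<Omega> where "\<Omega> \<equiv> form t"
abbreviation K where "K \<equiv> K_part t"
abbreviation P where "P \<equiv> P_part t"

lemma \<sigma>_closed [simp]: "x \<in> G \<Longrightarrow> \<sigma> x \<in> G"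
  and \<sigma>_\<sigma> [simp]: "x \<in> G \<Longrightarrow> \<sigma> (\<sigma> x) = x"
  and \<sigma>_add: "x \<in> G \<Longrightarrow> y \<in> G \<Longrightarrow> \<sigma> (x + y) = \<sigma> x + \<sigma> y"
  and \<sigma>_scale: "x \<in> G \<Longrightarrow> \<sigma> (c *\<^sub>R x) = c *\<^sub>R \<sigma> x"
  and \<sigma>_br: "x \<in> G \<Longrightarrow> y \<in> G \<Longrightarrow> \<sigma> (br x y) = br (\<sigma> x) (\<sigma> y)"
  using triple
  by (auto simp: symplectic_symmetric_triple_def lie_automorphism_def linear_map_on_def
      dest: bij_betwE)

lemma \<sigma>_neg: "x \<in> G \<Longrightarrow> \<sigma> (- x) = - \<sigma> x"
  using \<sigma>_scale[of x "-1"] by simp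

lemma \<sigma>_diff: "x \<in> G \<Longrightarrow> y \<in> G \<Longrightarrow> \<sigma> (x - y) = \<sigma> x - \<sigma> y"
  using \<sigma>_add[of x "- y"] \<sigma>_neg[of y] by simp

lemma \<sigma>_zero: "\<sigma> 0 = 0"
  using \<sigma>_scale[of 0 0] by simp

lemma sum_in_K: "x \<in> G \<Longrightarrow> x + \<sigma> x \<in> K"
  by (simp add: K_part_def \<sigma>_add add.commute)

lemma diff_in_P: "x \<in> G \<Longrightarrow> x - \<sigma> x \<in> P"
  by (simp add: P_part_def \<sigma>_diff)

lemma PG: "x \<in> P \<Longrightarrow> x \<in> G" and KG: "x \<in> K \<Longrightarrow> x \<in> G"
  by (auto simp: P_part_def K_part_def)

lemma subspace_P: "subspace P"
  by (rule subspaceI) (auto simp: P_part_def \<sigma>_zero \<sigma>_add \<sigma>_scale)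

lemma br_KP: "k \<in> K \<Longrightarrow> x \<in> P \<Longrightarrow> br k x \<in> P"
  by (auto simp: K_part_def P_part_def \<sigma>_br br_neg)

lemma bracket_span_P: "bracket_span t P = K"
  using triple by (simp add: symplectic_symmetric_triple_def bracket_span_def)

lemma K_faithful: "k \<in> K \<Longrightarrow> (\<And>x. x \<in> P \<Longrightarrow> br k x = 0) \<Longrightarrow> k = 0"
  using triple by (auto simp: symplectic_symmetric_triple_def)

lemma \<Omega>_symplectic: "symplectic_form_on P \<Omega>"
  using triple by (simp add: symplectic_symmetric_triple_def)

lemma \<Omega>_linear:
  assumes "x \<in> P" "y \<in> P" "z \<in> P"
  shows "\<Omega> (x + y) z = \<Omega> x z + \<Omega> y z" "\<Omega> z (x + y) = \<Omega> z x + \<Omega> z y"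
    "\<Omega> (c *\<^sub>R x) y = c * \<Omega> x y" "\<Omega> y (c *\<^sub>R x) = c * \<Omega> y x"
  using \<Omega>_symplectic assms
  by (auto simp: symplectic_form_on_def bilinear_map_on_def linear_map_on_def)

lemma \<Omega>_neg: "x \<in> P \<Longrightarrow> y \<in> P \<Longrightarrow> \<Omega> (- x) y = - \<Omega> x y"
  using \<Omega>_linear(3)[of x y x "-1"] by simp

lemma \<Omega>_zero: "y \<in> P \<Longrightarrow> \<Omega> 0 y = 0"
  using \<Omega>_linear(3)[of y y y 0] by simp

lemma \<Omega>_zero_right: "y \<in> P \<Longrightarrow> \<Omega> y 0 = 0"
  using \<Omega>_linear(4)[of y y y 0] by simp

lemma \<Omega>_skew:
  assumes "x \<in> P" "y \<in> P"
  shows "\<Omega> x y = - \<Omega> y x"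
proof -
  have z: "\<Omega> u u = 0" if "u \<in> P" for u
    using \<Omega>_symplectic that by (simp add: symplectic_form_on_def)
  have s: "x + y \<in> P" using assms subspace_P by (simp add: subspace_add)
  have "\<Omega> x (x + y) + \<Omega> y (x + y) = 0"
    using z[OF s] \<Omega>_linear(1)[OF assms s] by simp
  then show ?thesis using assms z by (simp add: \<Omega>_linear)
qed

lemma \<Omega>_nondegenerate: "x \<in> P \<Longrightarrow> (\<And>y. y \<in> P \<Longrightarrow> \<Omega> x y = 0) \<Longrightarrow> x = 0"
  using \<Omega>_symplectic by (auto simp: symplectic_form_on_def)

lemma \<Omega>_invariant: "k \<in> K \<Longrightarrow> x \<in> P \<Longrightarrow> y \<in> P \<Longrightarrow> \<Omega> (br k x) y + \<Omega> x (br k y) = 0"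
  using triple by (auto simp: symplectic_symmetric_triple_def)

text \<open>Here \<open>z - \<sigma> z\<close> is twice the \<open>P\<close>-component of \<open>z\<close>. Because the set is a subspace, it
  contains a perfect ideal as soon as it contains all brackets of that ideal.\<close>

lemma subspace_odd_part_annihilator:
  assumes y: "y \<in> P"
  shows "subspace {z \<in> G. \<Omega> (z - \<sigma> z) y = 0}" (is "subspace ?N")
proof (rule subspaceI)
  show "0 \<in> ?N" using y by (simp add: \<sigma>_zero \<Omega>_zero)
next
  fix u v assume u: "u \<in> ?N" and v: "v \<in> ?N"
  have eq: "u + v - \<sigma> (u + v) = (u - \<sigma> u) + (v - \<sigma> v)" using u v by (simp add: \<sigma>_add)
  have "\<Omega> (u + v - \<sigma> (u + v)) y = \<Omega> (u - \<sigma> u) y + \<Omega> (v - \<sigma> v) y"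
    unfolding eq using u v y by (intro \<Omega>_linear(1) diff_in_P) auto
  then show "u + v \<in> ?N" using u v by simp
next
  fix c u assume u: "u \<in> ?N"
  have eq: "c *\<^sub>R u - \<sigma> (c *\<^sub>R u) = c *\<^sub>R (u - \<sigma> u)"
    using u by (simp add: \<sigma>_scale scaleR_diff_right)
  have "\<Omega> (c *\<^sub>R u - \<sigma> (c *\<^sub>R u)) y = c * \<Omega> (u - \<sigma> u) y"
    unfolding eq using u y by (intro \<Omega>_linear(3) diff_in_P) auto
  then show "c *\<^sub>R u \<in> ?N" using u by simp
qed

text \<open>The \<open>P\<close>-component of a bracket \<open>[u, v]\<close> in \<open>I\<close> is a sum of terms \<open>[k, p]\<close> with \<open>k\<close> in
  \<open>K \<inter> I\<close>. Such a \<open>k\<close> kills \<open>J\<close>, so invariance gives \<open>\<Omega> [k, p] y = - \<Omega> p [k, y] = 0\<close> for \<open>y\<close> in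
  \<open>P \<inter> J\<close>.\<close>

lemma perfect_summand_orthogonal:
  assumes I: "lie_ideal I t" and J: "lie_ideal J t" and IJ: "I \<inter> J = {0}"
    and \<sigma>I: "\<sigma> ` I \<subseteq> I" and perf: "I \<subseteq> bracket_span t I"
    and x: "x \<in> P" "x \<in> I" and y: "y \<in> P" "y \<in> J"
  shows "\<Omega> x y = 0"
proof -
  let ?N = "{z \<in> G. \<Omega> (z - \<sigma> z) y = 0}"
  have IG: "u \<in> G" if "u \<in> I" for u using that ideal_subset[OF I] by blast
  have "subspace ?N" using y(1) by (rule subspace_odd_part_annihilator)
  moreover have "br u v \<in> ?N" if uv: "u \<in> I" "v \<in> I" for u v
  proof -
    have kp: "\<Omega> (br (u + \<sigma> u) (v - \<sigma> v)) y = 0" if "u \<in> I" "v \<in> I" for u v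
    proof -
      have k: "u + \<sigma> u \<in> I" using that \<sigma>I subspace_add[OF subspace_ideal[OF I]] by blast
      have "br (u + \<sigma> u) y = 0" using br_disjoint_ideals[OF I J IJ k y(2)] .
      then show ?thesis
        using \<Omega>_invariant[OF sum_in_K diff_in_P y(1), of u v] that IG
        by (simp add: \<Omega>_zero_right diff_in_P)
    qed
    have mem: "u \<in> G" "v \<in> G" "\<sigma> u \<in> G" "\<sigma> v \<in> G" using uv IG by auto
    let ?p = "br (u + \<sigma> u) (v - \<sigma> v)" and ?q = "br (v + \<sigma> v) (u - \<sigma> u)"
    have pq: "?p \<in> P" "?q \<in> P" "- ?q \<in> P"
      using br_KP[OF sum_in_K diff_in_P] mem subspace_neg[OF subspace_P] by auto
    (* four times the P-component of [u, v], written through brackets of K-parts with P-parts *)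
    have "?p - ?q = 2 *\<^sub>R (br u v - \<sigma> (br u v))"
      using mem br_anticommute[of v u] br_anticommute[of v "\<sigma> u"] br_anticommute[of "\<sigma> v" u]
        br_anticommute[of "\<sigma> v" "\<sigma> u"]
      by (simp add: br_linear br_diff \<sigma>_br algebra_simps scaleR_2)
    then have "br u v - \<sigma> (br u v) = (1/2) *\<^sub>R (?p + - ?q)" by simp
    then have "\<Omega> (br u v - \<sigma> (br u v)) y = (1/2) * \<Omega> (?p + - ?q) y"
      using \<Omega>_linear(3)[of "?p + - ?q" y y "1/2"] pq y(1) subspace_add[OF subspace_P] by metis
    also have "\<dots> = 0" using kp uv \<Omega>_linear(1)[OF pq(1,3) y(1)] \<Omega>_neg[OF pq(2) y(1)] by simp
    finally show ?thesis using mem by simp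
  qed
  ultimately have "bracket_span t I \<subseteq> ?N"
    unfolding bracket_span_def by (intro span_minimal) auto
  then have "\<Omega> (x - \<sigma> x) y = 0" using x perf by blast
  moreover have "x - \<sigma> x = 2 *\<^sub>R x" using x by (simp add: P_part_def scaleR_2)
  ultimately show ?thesis using x y by (simp add: \<Omega>_linear)
qed

text \<open>Stability under \<open>\<sigma>\<close> puts \<open>\<sigma> a + a\<close> in \<open>I\<close> and \<open>\<sigma> b + b\<close> in \<open>J\<close>; their sum vanishes when
  \<open>a + b\<close> is odd, so both vanish.\<close>

lemma P_components:
  assumes I: "lie_ideal I t" and J: "lie_ideal J t" and IJ: "I \<inter> J = {0}"
    and \<sigma>I: "\<sigma> ` I \<subseteq> I" and \<sigma>J: "\<sigma> ` J \<subseteq> J"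
    and ab: "a \<in> I" "b \<in> J" "a + b \<in> P"
  shows "a \<in> P" "b \<in> P"
proof -
  have mem: "a \<in> G" "b \<in> G" using ab ideal_subset[OF I] ideal_subset[OF J] by auto
  have "\<sigma> a + \<sigma> b = - (a + b)" using ab(3) mem by (simp add: P_part_def \<sigma>_add)
  moreover have "(\<sigma> a + a) + (\<sigma> b + b) = (\<sigma> a + \<sigma> b) + (a + b)" by (simp only: ac_simps)
  ultimately have eq: "\<sigma> a + a = - (\<sigma> b + b)"
    unfolding eq_neg_iff_add_eq_0 by (metis add.left_inverse)
  have "\<sigma> a + a \<in> I" using ab \<sigma>I subspace_add[OF subspace_ideal[OF I]] by blast
  moreover have bJ: "\<sigma> b + b \<in> J" using ab \<sigma>J subspace_add[OF subspace_ideal[OF J]] by blast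
  then have "\<sigma> a + a \<in> J" using eq subspace_neg[OF subspace_ideal[OF J] bJ] by simp
  ultimately have a0: "\<sigma> a + a = 0" using IJ by blast
  then have b0: "\<sigma> b + b = 0" using eq by (metis neg_equal_0_iff_equal)
  from a0 b0 show "a \<in> P" "b \<in> P"
    using mem by (simp_all add: P_part_def eq_neg_iff_add_eq_0)
qed

text \<open>By \<open>P_components\<close>, \<open>P\<close> splits along \<open>I\<close> and \<open>J\<close>. The part in \<open>J\<close> is annihilated by \<open>K \<inter> I\<close> and
  orthogonal to \<open>P \<inter> I\<close>, so faithfulness and nondegeneracy only have to be tested on \<open>P \<inter> I\<close>.
  That \<open>K \<inter> I\<close> is spanned by brackets of \<open>P \<inter> I\<close> is \<open>bracket_span_component\<close>.\<close>

lemma restrict_triple: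
  assumes I: "lie_ideal I t" and J: "lie_ideal J t" and D: "direct_sum_decomp G I J"
    and \<sigma>I: "\<sigma> ` I \<subseteq> I" and \<sigma>J: "\<sigma> ` J \<subseteq> J"
    and orth: "\<And>x y. x \<in> P \<Longrightarrow> x \<in> I \<Longrightarrow> y \<in> P \<Longrightarrow> y \<in> J \<Longrightarrow> \<Omega> x y = 0"
  shows "symplectic_symmetric_triple (t\<lparr>lie_carrier := I\<rparr>)"
proof -
  let ?s = "t\<lparr>lie_carrier := I\<rparr>"
  have IJ: "I \<inter> J = {0}" using D by (simp add: direct_sum_decomp_def)
  have IG: "I \<subseteq> G" using I by (rule ideal_subset)
  have Ks: "K_part ?s = K \<inter> I" and Ps: "P_part ?s = P \<inter> I"
    using IG by (auto simp: K_part_def P_part_def)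
  have comp: "\<exists>a b. x = a + b \<and> a \<in> P \<inter> I \<and> b \<in> P \<inter> J" if x: "x \<in> P" for x
  proof -
    obtain a b where ab: "a \<in> I" "b \<in> J" "x = a + b"
      using direct_sum_decomp_obtain[OF D PG[OF x]] .
    then show ?thesis using P_components[OF I J IJ \<sigma>I \<sigma>J ab(1,2)] x by blast
  qed
  have "fd_lie_algebra ?s"
  proof -
    have "finite_dim_subspace I"
      using fd_lie finite_dim_subspace_subset subspace_ideal[OF I] IG
      by (auto simp: fd_lie_algebra_def)
    moreover have "bilinear_map_on I br"
      using fd_lie IG bilinear_map_on_subset by (auto simp: fd_lie_algebra_def)
    ultimately show ?thesis
      using IG ideal_br[OF I] br_self br_jacobi by (auto simp: fd_lie_algebra_def subset_iff)
  qed
  moreover have "lie_automorphism ?s \<sigma>"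
  proof -
    have "bij_betw \<sigma> I I"
      by (rule bij_betw_byWitness[where f' = \<sigma>]) (use \<sigma>I IG in auto)
    then show ?thesis
      using IG \<sigma>_add \<sigma>_scale \<sigma>_br by (auto simp: lie_automorphism_def linear_map_on_def subset_iff)
  qed
  moreover have "bracket_span t (P \<inter> I) = K \<inter> I"
  proof
    have "bracket_span t (P \<inter> I) \<subseteq> bracket_span t P"
      unfolding bracket_span_def by (intro span_mono) blast
    moreover have "bracket_span t (P \<inter> I) \<subseteq> I"
      by (rule bracket_span_subset_ideal[OF I]) simp
    ultimately show "bracket_span t (P \<inter> I) \<subseteq> K \<inter> I" using bracket_span_P by blast
    show "K \<inter> I \<subseteq> bracket_span t (P \<inter> I)"
      using bracket_span_component[OF I J IJ, of "P \<inter> I" "P \<inter> J" P] comp bracket_span_P by blast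
  qed
  moreover have "\<forall>k\<in>K \<inter> I. (\<forall>x\<in>P \<inter> I. br k x = 0) \<longrightarrow> k = 0"
  proof (intro ballI impI, rule K_faithful)
    fix k assume k: "k \<in> K \<inter> I" and kz: "\<forall>x\<in>P \<inter> I. br k x = 0"
    show "k \<in> K" using k by simp
    fix x assume "x \<in> P"
    then obtain a b where ab: "x = a + b" "a \<in> P \<inter> I" "b \<in> P \<inter> J" using comp by blast
    have "br k b = 0" using br_disjoint_ideals[OF I J IJ, of k b] k ab by simp
    then show "br k x = 0" using ab k kz KG PG by (simp add: br_linear)
  qed
  moreover have "symplectic_form_on (P \<inter> I) \<Omega>"
  proof -
    have "x = 0" if x: "x \<in> P" "x \<in> I" and xz: "\<forall>y\<in>P \<inter> I. \<Omega> x y = 0" for x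
    proof (rule \<Omega>_nondegenerate[OF x(1)])
      fix y assume "y \<in> P"
      then obtain a b where ab: "y = a + b" "a \<in> P \<inter> I" "b \<in> P \<inter> J" using comp by blast
      then show "\<Omega> x y = 0" using x xz orth by (simp add: \<Omega>_linear)
    qed
    moreover have "bilinear_map_on (P \<inter> I) \<Omega>"
      using \<Omega>_symplectic bilinear_map_on_subset[of P \<Omega> "P \<inter> I"]
      by (simp add: symplectic_form_on_def)
    ultimately show ?thesis using \<Omega>_symplectic by (simp add: symplectic_form_on_def)
  qed
  moreover have "\<forall>x\<in>I. \<sigma> (\<sigma> x) = x" using IG by auto
  moreover have "\<forall>k\<in>K \<inter> I. \<forall>x\<in>P \<inter> I. \<forall>y\<in>P \<inter> I. \<Omega> (br k x) y + \<Omega> x (br k y) = 0"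
    using \<Omega>_invariant by blast
  ultimately show ?thesis
    unfolding symplectic_symmetric_triple_def Ks Ps bracket_span_def by simp
qed

lemma invariant_decomp_isomorphic:
  assumes I: "lie_ideal I t" and J: "lie_ideal J t" and D: "direct_sum_decomp G I J"
    and \<sigma>I: "\<sigma> ` I \<subseteq> I" and \<sigma>J: "\<sigma> ` J \<subseteq> J"
    and orth: "\<And>x y. x \<in> P \<Longrightarrow> x \<in> I \<Longrightarrow> y \<in> P \<Longrightarrow> y \<in> J \<Longrightarrow> \<Omega> x y = 0"
  shows "triple_isomorphic t (triple_sum (t\<lparr>lie_carrier := I\<rparr>) (t\<lparr>lie_carrier := J\<rparr>))"
proof -
  have IJ: "I \<inter> J = {0}" using D by (simp add: direct_sum_decomp_def)
  have mem: "a \<in> G" "b \<in> G" if "a \<in> I" "b \<in> J" for a b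
    using that ideal_subset[OF I] ideal_subset[OF J] by auto
  note sI = subspace_ideal[OF I] and sJ = subspace_ideal[OF J]
  have uniq: "a = a' \<and> b = b'"
    if "a \<in> I" "b \<in> J" "a' \<in> I" "b' \<in> J" "a + b = a' + b'" for a b a' b'
  proof -
    have "a - a' = b' - b" using that(5) by (simp add: algebra_simps)
    then have "a - a' \<in> I \<inter> J" using that subspace_diff[OF sI] subspace_diff[OF sJ] by force
    then show ?thesis using that(5) IJ by simp
  qed
  define f where "f x = (THE q. fst q \<in> I \<and> snd q \<in> J \<and> x = fst q + snd q)" for x
  have f: "f (a + b) = (a, b)" if "a \<in> I" "b \<in> J" for a b
    unfolding f_def using that uniq by (intro the_equality) (auto simp: prod_eq_iff)
  have ex: "\<exists>a b. a \<in> I \<and> b \<in> J \<and> x = a + b" if "x \<in> G" for x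
    using direct_sum_decomp_obtain[OF D that] by metis
  have G_sum: "a + b \<in> G" if "a \<in> I" "b \<in> J" for a b using mem that by simp
  have "linear_map_on G f"
    unfolding linear_map_on_def
  proof safe
    fix x y assume "x \<in> G" "y \<in> G"
    then obtain a b a' b' where ab: "a \<in> I" "b \<in> J" "x = a + b" "a' \<in> I" "b' \<in> J" "y = a' + b'"
      using ex[of x] ex[of y] by blast
    have "x + y = (a + a') + (b + b')" using ab by (simp add: algebra_simps)
    then have "f (x + y) = (a + a', b + b')"
      using f ab subspace_add[OF sI] subspace_add[OF sJ] by metis
    then show "f (x + y) = f x + f y" using ab f by simp
  next
    fix c x assume "x \<in> G"
    then obtain a b where ab: "a \<in> I" "b \<in> J" "x = a + b" using ex by metis
    then have "f (c *\<^sub>R x) = (c *\<^sub>R a, c *\<^sub>R b)"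
      using f subspace_scale[OF sI] subspace_scale[OF sJ] by (simp add: scaleR_add_right)
    then show "f (c *\<^sub>R x) = c *\<^sub>R f x" using ab f by simp
  qed
  moreover have "bij_betw f G (I \<times> J)"
    by (rule bij_betw_byWitness[where f' = "\<lambda>q. fst q + snd q"])
      (use ex f G_sum in force)+
  moreover have "f (br x y) = (br (fst (f x)) (fst (f y)), br (snd (f x)) (snd (f y)))"
    if xy: "x \<in> G" "y \<in> G" for x y
  proof -
    obtain a b a' b' where ab: "a \<in> I" "b \<in> J" "x = a + b" "a' \<in> I" "b' \<in> J" "y = a' + b'"
      using ex[OF xy(1)] ex[OF xy(2)] by blast
    have m: "a \<in> G" "b \<in> G" "a' \<in> G" "b' \<in> G" using ab mem by blast+
    have "br a b' = 0" "br b a' = 0"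
      using br_disjoint_ideals[OF I J IJ, of a b'] br_disjoint_ideals[OF J I, of b a'] IJ ab
      by (auto simp: Int_commute)
    then have "br x y = br a a' + br b b'" using m by (simp add: ab br_linear)
    moreover have "br a a' \<in> I" "br b b' \<in> J" using ab m ideal_br I J by blast+
    ultimately show ?thesis using ab f by simp
  qed
  moreover have "f (\<sigma> x) = map_prod \<sigma> \<sigma> (f x)" if x: "x \<in> G" for x
  proof -
    obtain a b where ab: "a \<in> I" "b \<in> J" "x = a + b" using ex[OF x] by blast
    have "\<sigma> x = \<sigma> a + \<sigma> b" using ab mem by (simp add: \<sigma>_add)
    moreover have "\<sigma> a \<in> I" "\<sigma> b \<in> J" using ab \<sigma>I \<sigma>J by blast+
    ultimately show ?thesis using ab f by simp
  qed
  moreover have "\<Omega> x y = \<Omega> (fst (f x)) (fst (f y)) + \<Omega> (snd (f x)) (snd (f y))"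
    if xy: "x \<in> P" "y \<in> P" for x y
  proof -
    obtain a b a' b' where ab: "a \<in> I" "b \<in> J" "x = a + b" "a' \<in> I" "b' \<in> J" "y = a' + b'"
      using ex[OF PG[OF xy(1)]] ex[OF PG[OF xy(2)]] by blast
    have m: "a \<in> P" "b \<in> P" "a' \<in> P" "b' \<in> P"
      using P_components[OF I J IJ \<sigma>I \<sigma>J] ab xy by blast+
    have "\<Omega> x y = \<Omega> a a' + \<Omega> b a' + (\<Omega> a b' + \<Omega> b b')"
      using m subspace_add[OF subspace_P] by (simp add: ab \<Omega>_linear)
    moreover have "\<Omega> a b' = 0" "\<Omega> b a' = 0"
      using orth m ab \<Omega>_skew[of b a'] by auto
    ultimately show ?thesis using ab f by simp
  qed
  ultimately show ?thesis
    unfolding triple_isomorphic_def triple_sum_def by (intro exI[of _ f]) simp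
qed

lemma indecomposable_invariant_decomp:
  assumes ind: "indecomposable_triple t"
    and I: "lie_ideal I t" and J: "lie_ideal J t" and D: "direct_sum_decomp G I J"
    and \<sigma>I: "\<sigma> ` I \<subseteq> I" and \<sigma>J: "\<sigma> ` J \<subseteq> J"
    and perf: "I \<subseteq> bracket_span t I"
  shows "I = {0} \<or> J = {0}"
proof (rule ccontr)
  assume nz: "\<not> (I = {0} \<or> J = {0})"
  have IJ: "I \<inter> J = {0}" using D by (simp add: direct_sum_decomp_def)
  have orth: "\<Omega> x y = 0" if "x \<in> P" "x \<in> I" "y \<in> P" "y \<in> J" for x y
    using perfect_summand_orthogonal[OF I J IJ \<sigma>I perf that] .
  have orth': "\<Omega> x y = 0" if "x \<in> P" "x \<in> J" "y \<in> P" "y \<in> I" for x y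
    using orth[of y x] \<Omega>_skew[of x y] that by simp
  have "symplectic_symmetric_triple (t\<lparr>lie_carrier := I\<rparr>)"
    by (rule restrict_triple[OF I J D \<sigma>I \<sigma>J orth])
  moreover have "symplectic_symmetric_triple (t\<lparr>lie_carrier := J\<rparr>)"
    by (rule restrict_triple[OF J I direct_sum_decomp_sym[OF D] \<sigma>J \<sigma>I orth'])
  moreover have "triple_isomorphic t (triple_sum (t\<lparr>lie_carrier := I\<rparr>) (t\<lparr>lie_carrier := J\<rparr>))"
    by (rule invariant_decomp_isomorphic[OF I J D \<sigma>I \<sigma>J orth])
  ultimately show False
    using ind nz unfolding indecomposable_triple_def
    by (metis (no_types, lifting) lie_alg.select_convs(1) lie_alg.simps(3) lie_alg.surjective
        lie_alg.update_convs(1))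
qed

section \<open>Exclusion of proper ideals\<close>

lemma \<sigma>_centralizer:
  assumes I: "I \<subseteq> G" and \<sigma>I: "\<sigma> ` I \<subseteq> I"
  shows "\<sigma> ` centralizer t I \<subseteq> centralizer t I"
proof
  fix z assume "z \<in> \<sigma> ` centralizer t I"
  then obtain c where c: "c \<in> centralizer t I" "z = \<sigma> c" by blast
  then have cG: "c \<in> G" by (simp add: centralizer_def)
  have "br z y = 0" if y: "y \<in> I" for y
  proof -
    have "\<sigma> y \<in> I" using y \<sigma>I by blast
    then have "br c (\<sigma> y) = 0" using c(1) by (simp add: centralizer_def)
    then have "br (\<sigma> c) (\<sigma> (\<sigma> y)) = 0"
      using \<sigma>_br[of c "\<sigma> y"] cG y I \<sigma>_zero by (auto simp: subset_iff)
    then show ?thesis using c y I by (auto simp: subset_iff)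
  qed
  then show "z \<in> centralizer t I" using c cG by (simp add: centralizer_def)
qed

lemma \<sigma>_bracket_span: "\<sigma> ` bracket_span t G \<subseteq> bracket_span t G"
proof -
  let ?N = "{x \<in> G. \<sigma> x \<in> bracket_span t G}"
  note s = subspace_ideal[OF ideal_bracket_span]
  have "subspace ?N"
    using s by (intro subspaceI) (auto simp: \<sigma>_zero \<sigma>_add \<sigma>_scale subspace_0 subspace_add subspace_scale)
  moreover have "br x y \<in> ?N" if "x \<in> G" "y \<in> G" for x y
    using that by (auto simp: \<sigma>_br bracket_span_def intro!: span_base) (metis \<sigma>_closed)
  ultimately have "bracket_span t G \<subseteq> ?N"
    unfolding bracket_span_def[of t G] by (intro span_minimal) (auto simp: bracket_span_def)
  then show ?thesis by blast
qed

lemma ideal_\<sigma>_image: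
  assumes I: "lie_ideal I t"
  shows "lie_ideal (\<sigma> ` I) t"
proof -
  have IG: "u \<in> G" if "u \<in> I" for u using that ideal_subset[OF I] by blast
  note s = subspace_ideal[OF I]
  have "subspace (\<sigma> ` I)"
  proof (rule subspaceI)
    show "0 \<in> \<sigma> ` I" using subspace_0[OF s] \<sigma>_zero by force
    fix x y assume "x \<in> \<sigma> ` I" "y \<in> \<sigma> ` I"
    then obtain u v where uv: "x = \<sigma> u" "y = \<sigma> v" "u \<in> I" "v \<in> I" by blast
    then have "x + y = \<sigma> (u + v)" using IG by (simp add: \<sigma>_add)
    then show "x + y \<in> \<sigma> ` I" using subspace_add[OF s] uv by blast
  next
    fix c x assume "x \<in> \<sigma> ` I"
    then obtain u where u: "x = \<sigma> u" "u \<in> I" by blast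
    then have "c *\<^sub>R x = \<sigma> (c *\<^sub>R u)" using IG by (simp add: \<sigma>_scale)
    then show "c *\<^sub>R x \<in> \<sigma> ` I" using subspace_scale[OF s] u by blast
  qed
  moreover have "br x y \<in> \<sigma> ` I" if "x \<in> G" "y \<in> \<sigma> ` I" for x y
  proof -
    obtain u where u: "y = \<sigma> u" "u \<in> I" using \<open>y \<in> \<sigma> ` I\<close> by blast
    then have "br x y = \<sigma> (br (\<sigma> x) u)" using that IG by (simp add: \<sigma>_br)
    then show ?thesis using ideal_br[OF I _ u(2)] that by auto
  qed
  ultimately show ?thesis using IG by (auto simp: lie_ideal_def)
qed

text \<open>If \<open>I\<close> and \<open>\<sigma> I\<close> are complementary, then \<open>P\<close> is the antidiagonal \<open>{x - \<sigma> x}\<close> and \<open>\<Omega>\<close> pulls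
  back to an invariant antisymmetric form on the perfect algebra \<open>I\<close>, which must vanish.\<close>

lemma no_swapped_ideal:
  assumes I: "lie_ideal I t" and D: "direct_sum_decomp G I (\<sigma> ` I)"
    and perf: "I \<subseteq> bracket_span t I"
  shows "I = {0}"
proof -
  have IG: "u \<in> G" if "u \<in> I" for u using that ideal_subset[OF I] by blast
  have IJ: "I \<inter> \<sigma> ` I = {0}" using D by (simp add: direct_sum_decomp_def)
  have J: "lie_ideal (\<sigma> ` I) t" using ideal_\<sigma>_image[OF I] .
  define w where "w x y = \<Omega> (x - \<sigma> x) (y - \<sigma> y)" for x y
  have act: "br (x + \<sigma> x) (y - \<sigma> y) = br x y - \<sigma> (br x y)" if "x \<in> I" "y \<in> I" for x y
  proof -
    have "br x (\<sigma> y) = 0" "br (\<sigma> x) y = 0"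
      using br_disjoint_ideals[OF I J IJ, of x "\<sigma> y"] br_disjoint_ideals[OF J I, of "\<sigma> x" y] IJ that
      by (auto simp: Int_commute)
    then show ?thesis using that IG by (simp add: br_linear br_diff \<sigma>_br)
  qed
  have br0: "w (br x y) z = 0" if "x \<in> I" "y \<in> I" "z \<in> I" for x y z
  proof (rule invariant_skew_form_bracket_zero[OF _ _ _ I that])
    fix x y assume xy: "x \<in> I" "y \<in> I"
    show "w x y = - w y x" unfolding w_def by (intro \<Omega>_skew diff_in_P IG xy)
    have odd: "- x - \<sigma> (- x) = - (x - \<sigma> x)" using xy IG by (simp add: \<sigma>_neg)
    show "w (- x) y = - w x y"
      unfolding w_def odd by (intro \<Omega>_neg diff_in_P IG xy)
    fix z assume "z \<in> I"
    then show "w (br x y) z + w y (br x z) = 0"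
      using xy IG \<Omega>_invariant[OF sum_in_K diff_in_P diff_in_P, of x y z]
      by (simp add: w_def act)
  qed
  have w0: "w x z = 0" if x: "x \<in> I" and z: "z \<in> I" for x z
  proof -
    let ?N = "{x \<in> G. w x z = 0}"
    have zP: "z - \<sigma> z \<in> P" using z IG diff_in_P by blast
    have "subspace ?N" unfolding w_def using zP by (rule subspace_odd_part_annihilator)
    then have "bracket_span t I \<subseteq> ?N"
      unfolding bracket_span_def using br0 z IG by (intro span_minimal) auto
    then show ?thesis using x perf by blast
  qed
  have "x = 0" if x: "x \<in> I" for x
  proof -
    have xG: "x \<in> G" using x IG by blast
    have "x - \<sigma> x = 0"
    proof (rule \<Omega>_nondegenerate[OF diff_in_P[OF xG]])
      fix y assume y: "y \<in> P"
      obtain a b where ab: "a \<in> I" "b \<in> I" "y = a + \<sigma> b"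
        using direct_sum_decomp_obtain[OF D PG[OF y]] by blast
      have mem: "a \<in> G" "b \<in> G" using ab IG by auto
      have "\<sigma> a + b = - (a + \<sigma> b)" using y ab mem by (simp add: P_part_def \<sigma>_add)
      moreover have "(a + b) + (\<sigma> a + \<sigma> b) = (\<sigma> a + b) + (a + \<sigma> b)" by (simp only: ac_simps)
      ultimately have eq: "a + b = - (\<sigma> a + \<sigma> b)"
        unfolding eq_neg_iff_add_eq_0 by (metis add.left_inverse)
      have "a + b \<in> I" using ab subspace_add[OF subspace_ideal[OF I]] by blast
      moreover have "\<sigma> a + \<sigma> b \<in> \<sigma> ` I"
        using ab subspace_add[OF subspace_ideal[OF J]] by blast
      then have "a + b \<in> \<sigma> ` I"
        unfolding eq by (rule subspace_neg[OF subspace_ideal[OF J]])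
      ultimately have "a + b = 0" using IJ by blast
      then have "b = - a" by (simp only: add_eq_0_iff)
      then have "y = a - \<sigma> a" using ab mem by (simp add: \<sigma>_neg)
      then show "\<Omega> (x - \<sigma> x) y = 0" using w0[OF x ab(1)] by (simp add: w_def)
    qed
    then have "x = \<sigma> x" by simp
    then have "x \<in> I \<inter> \<sigma> ` I" using x by blast
    then show ?thesis using IJ by blast
  qed
  then show ?thesis using subspace_0[OF subspace_ideal[OF I]] by blast
qed

lemma reductive_indecomposable_simple:
  assumes red: "reductive_lie t" and ind: "indecomposable_triple t" and nonflat: "K \<noteq> {0}"
  shows "simple_lie t"
proof -
  let ?D = "bracket_span t G" and ?Z = "centralizer t G"
  note D = ideal_bracket_span and Z = ideal_centralizer[OF ideal_whole]
  have nonab: "\<not> abelian_lie t"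
  proof
    assume "abelian_lie t"
    then have "k = 0" if "k \<in> K" for k
      using K_faithful[OF that] KG[OF that] PG by (auto simp: abelian_lie_def)
    moreover have "0 \<in> K" by (simp add: K_part_def \<sigma>_zero)
    ultimately show False using nonflat by blast
  qed
  then obtain u v where "u \<in> G" "v \<in> G" "br u v \<noteq> 0" by (auto simp: abelian_lie_def)
  moreover then have "br u v \<in> ?D" by (auto simp: bracket_span_def intro: span_base)
  ultimately have "?D \<noteq> {0}" by auto
  moreover have "?D = {0} \<or> ?Z = {0}"
  proof (rule indecomposable_invariant_decomp[OF ind D Z derived_centre_decomp[OF red]])
    show "\<sigma> ` ?D \<subseteq> ?D" by (rule \<sigma>_bracket_span)
    show "\<sigma> ` ?Z \<subseteq> ?Z" by (rule \<sigma>_centralizer) auto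
    show "?D \<subseteq> bracket_span t ?D" by (rule summand_perfect[OF D Z derived_centre_decomp[OF red]]) simp
  qed
  ultimately have Z0: "?Z = {0}" by blast
  have GD: "G \<subseteq> ?D"
    using derived_centre_decomp[OF red] Z0 by (auto simp: direct_sum_decomp_def)
  have perf: "I \<subseteq> bracket_span t I" if I: "lie_ideal I t" for I
    using summand_perfect[OF I ideal_centralizer[OF I] centralizer_complement[OF red Z0 I]]
      ideal_subset[OF I] GD by blast
  have stable: "I = {0} \<or> I = G" if I: "lie_ideal I t" and \<sigma>I: "\<sigma> ` I \<subseteq> I" for I
  proof -
    note dec = centralizer_complement[OF red Z0 I]
    have "I = {0} \<or> centralizer t I = {0}"
      using indecomposable_invariant_decomp[OF ind I ideal_centralizer[OF I] dec \<sigma>I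
          \<sigma>_centralizer[OF ideal_subset[OF I] \<sigma>I] perf[OF I]] .
    then show ?thesis using dec by (auto simp: direct_sum_decomp_def)
  qed
  have "I = {0} \<or> I = G" if I: "lie_ideal I t" for I
  proof (rule ccontr)
    assume proper: "\<not> (I = {0} \<or> I = G)"
    have IG: "I \<subseteq> G" using I by (rule ideal_subset)
    have J: "lie_ideal (\<sigma> ` I) t" using ideal_\<sigma>_image[OF I] .
    have JG: "\<sigma> ` I \<subseteq> G" using J by (rule ideal_subset)
    have \<sigma>\<sigma>: "\<sigma> (\<sigma> x) = x" if "x \<in> I" for x using that IG by auto
    have "lie_ideal (I \<inter> \<sigma> ` I) t"
      using I J by (auto simp: lie_ideal_def subspace_inter)
    moreover have "\<sigma> ` (I \<inter> \<sigma> ` I) \<subseteq> I \<inter> \<sigma> ` I" using \<sigma>\<sigma> by auto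
    ultimately have "I \<inter> \<sigma> ` I = {0} \<or> I \<inter> \<sigma> ` I = G" by (rule stable)
    then have int: "I \<inter> \<sigma> ` I = {0}" using proper IG by blast
    let ?S = "{x + y | x y. x \<in> I \<and> y \<in> \<sigma> ` I}"
    have "lie_ideal ?S t"
      unfolding lie_ideal_def
    proof (intro conjI ballI)
      show "subspace ?S" by (intro subspace_sums subspace_ideal I J)
      show "?S \<subseteq> G" using IG JG by (auto simp: subset_iff)
      fix x y assume x: "x \<in> G" and "y \<in> ?S"
      then obtain a b where ab: "a \<in> I" "b \<in> \<sigma> ` I" "y = a + b" by blast
      then have "br x y = br x a + br x b" using x IG JG by (simp add: br_linear subset_iff)
      then show "br x y \<in> ?S" using ideal_br[OF I x ab(1)] ideal_br[OF J x ab(2)] by blast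
    qed
    moreover have "\<sigma> ` ?S \<subseteq> ?S"
    proof
      fix z assume "z \<in> \<sigma> ` ?S"
      then obtain a b where ab: "a \<in> I" "b \<in> I" "z = \<sigma> (a + \<sigma> b)" by blast
      then have "z = b + \<sigma> a" using IG by (simp add: \<sigma>_add subset_iff add.commute)
      then show "z \<in> ?S" using ab by blast
    qed
    ultimately have "?S = {0} \<or> ?S = G" by (rule stable)
    moreover have "I \<subseteq> ?S"
    proof
      fix x assume "x \<in> I"
      then have "x = x + 0 \<and> x \<in> I \<and> 0 \<in> \<sigma> ` I" using int by auto
      then show "x \<in> ?S" by blast
    qed
    ultimately have "G = ?S" using proper subspace_0[OF subspace_ideal[OF I]] by blast
    then have "direct_sum_decomp G I (\<sigma> ` I)" using int by (simp add: direct_sum_decomp_def)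
    then show False using no_swapped_ideal[OF I _ perf[OF I]] proper by blast
  qed
  then show ?thesis using fd_lie nonab by (simp add: simple_lie_def)
qed

end

theorem proposition3p5p4:
  fixes t :: "'a::real_vector triple"
  assumes "symplectic_symmetric_triple t"
    and "reductive_triple t"
    and "indecomposable_triple t"
    and "\<not> flat_triple t"
  shows "simple_triple t"
proof -
  interpret sympl_sym_triple t by unfold_locales (fact assms(1))
  show ?thesis
    using reductive_indecomposable_simple assms(2-4)
    by (simp add: reductive_triple_def flat_triple_def simple_triple_def)
qed

end
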